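(* Suppose that each $f_i$, $i\in\mathcal{V}$, is strongly convex over $X_i$ with convexity parameter $\theta_i>0$, that $\mathbf{0}_d\in\operatorname{int}\bigcap_{i\in\mathcal{V}}X_i$, and that the graph $(\mathcal{V},\mathcal{E}_\infty)$ is connected, where $\mathcal{E}_\infty:=\{\{i,j\}:\{i,j\}\in\mathcal{E}^k\text{ for infinitely many }k\ge0\}$. Let $(\mathbf{w}^k)_{k=0}^\infty$ and $(\mathbf{x}^k)_{k=0}^\infty$ be the dual and primal iterates generated by the Fenchel dual gradient method. If there is a finite interval $[\underline{\alpha},\bar{\alpha}]$ with $\alpha^k\in[\underline{\alpha},\bar{\alpha}]\subset(0,2/\delta)$ for all $k\ge0$, where $\delta>0$ is a constant satisfying $H_{\mathcal{G}^k}\preceq\delta\Lambda_L^{-1}$ for all $k\ge0$, then $$\lim_{k\to\infty}\|P_{S^\bot}(\mathbf{x}^k)\|=0,\quad \lim_{k\to\infty}D(\mathbf{w}^k)=D^\star,\quad \lim_{k\to\infty}F(\mathbf{x}^k)=F^\star,\quad \lim_{k\to\infty}\mathbf{x}^k=\mathbf{x}^\star.$$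
   Context: Problem. Let $n\ge2$, $d\ge1$, $\mathcal{V}=\{1,\ldots,n\}$. For each $i\in\mathcal{V}$ let $f_i:\mathbb{R}^d\to\mathbb{R}$ be a convex function and $X_i\subseteq\mathbb{R}^d$ a closed convex set. A subgradient of $f_i$ at $x$ is a vector $g\in\mathbb{R}^d$ with $f_i(y)-f_i(x)-g^T(y-x)\ge0$ for all $y\in\mathbb{R}^d$. "$f_i$ is strongly convex over $X_i$ with convexity parameter $\theta_i>0$" means $f_i(y)-f_i(x)-g^T(y-x)\ge\theta_i\|y-x\|^2/2$ for all $x,y\in X_i$ and every subgradient $g$ of $f_i$ at $x$. $\|\cdot\|$ is the Euclidean norm. For $\mathbf{x}=(x_1^T,\ldots,x_n^T)^T\in\mathbb{R}^{nd}$ (blocks $x_i\in\mathbb{R}^d$) put $F(\mathbf{x})=\sum_{i\in\mathcal{V}}f_i(x_i)$. Let $S=\{\mathbf{x}\in\mathbb{R}^{nd}:x_1=\cdots=x_n\}$ and $S^\bot=\{\mathbf{w}\in\mathbb{R}^{nd}:w_1+\cdots+w_n=\mathbf{0}_d\}$, its orthogonal complement; $P_{S^\bot}$ is the orthogonal projection onto $S^\bot$. $F^\star$ is the optimal value and $\mathbf{x}^\star$ the unique optimal solution of: minimize $F(\mathbf{x})$ subject to $x_i\in X_i$ for all $i\in\mathcal{V}$ and $\mathbf{x}\in S$. Fenchel dual. $d_i(w_i)=\sup_{x\in X_i}\{w_i^Tx-f_i(x)\}$ and $D(\mathbf{w})=\sum_{i\in\mathcal{V}}d_i(w_i)$ for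 $\mathbf{w}=(w_1^T,\ldots,w_n^T)^T$. The dual problem is: maximize $-D(\mathbf{w})$ subject to $\mathbf{w}\in S^\bot$; $D^\star=\min_{\mathbf{w}\in S^\bot}D(\mathbf{w})$. Let $L_i=1/\theta_i$ and $\Lambda_L=\operatorname{diag}(L_1,\ldots,L_n)$. Network. For each $k\in\{0,1,\ldots\}$, $\mathcal{G}^k=(\mathcal{V},\mathcal{E}^k)$ is an undirected graph without self-loops, with $\mathcal{E}^k\ne\emptyset$, and $\mathcal{N}_i^k=\{j:\{i,j\}\in\mathcal{E}^k\}$. Weights $h_{ij}^k=h_{ji}^k$ are given for $\{i,j\}\in\mathcal{E}^k$, all lying in a fixed finite interval $[\underline{h},\bar{h}]\subset(0,\infty)$. The weight matrix $H_{\mathcal{G}^k}\in\mathbb{R}^{n\times n}$ has entries $[H_{\mathcal{G}^k}]_{ii}=\sum_{s\in\mathcal{N}_i^k}h_{is}^k$, $[H_{\mathcal{G}^k}]_{ij}=-h_{ij}^k$ if $\{i,j\}\in\mathcal{E}^k$, and $0$ otherwise. $M\preceq M'$ means $M'-M$ is positive semidefinite. Algorithm (Fenchel dual gradient method) with step-sizes $\alpha^k>0$: start from any $\mathbf{w}^0\in S^\bot$; for all $k\ge0$ and $i\in\mathcal{V}$, $x_i^k=\operatorname{arg\,max}_{x\in X_i}\{(w_i^k)^Tx-f_i(x)\}$ (unique maximizer) and $w_i^{k+1}=w_i^k-\alpha^k\sum_{j\in\mathcal{N}_i^k}h_{ij}^k(x_i^k-x_j^k)$. Write $\mathbf{w}^k=((w_1^k)^T,\ldots,(w_n^k)^T)^T$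 and $\mathbf{x}^k=((x_1^k)^T,\ldots,(x_n^k)^T)^T$. *)

theory Defs
  imports "HOL-Analysis.Analysis"
begin

text \<open>
  Nodes are the elements of a finite type \<open>'n\<close>. A stacked vector
  \<open>(x\<^sub>1, \<dots>, x\<^sub>n)\<close> of blocks in \<open>real ^ 'd\<close> has type \<open>real ^ 'd ^ 'n\<close>, whose norm is the
  Euclidean norm of the concatenation.
\<close>

subsection \<open>Convexity\<close>

definition subgradient :: "(real ^ 'd \<Rightarrow> real) \<Rightarrow> real ^ 'd \<Rightarrow> real ^ 'd \<Rightarrow> bool" where
  "subgradient f x g \<longleftrightarrow> (\<forall>y. f y - f x - g \<bullet> (y - x) \<ge> 0)"

text \<open>The points range over \<open>X\<close>, but \<open>g\<close> ranges over the subgradients of \<open>f\<close> on the whole space.\<close>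

definition strongly_convex_over ::
    "(real ^ 'd \<Rightarrow> real) \<Rightarrow> (real ^ 'd) set \<Rightarrow> real \<Rightarrow> bool" where
  "strongly_convex_over f X \<theta> \<longleftrightarrow>
     \<theta> > 0 \<and>
     (\<forall>x\<in>X. \<forall>y\<in>X. \<forall>g. subgradient f x g \<longrightarrow>
        f y - f x - g \<bullet> (y - x) \<ge> \<theta> * (norm (y - x))\<^sup>2 / 2)"

subsection \<open>Primal problem\<close>

definition primal_obj :: "('n \<Rightarrow> real ^ 'd \<Rightarrow> real) \<Rightarrow> real ^ 'd ^ 'n::finite \<Rightarrow> real" where
  "primal_obj f x = (\<Sum>i\<in>UNIV. f i (x $ i))"

definition consensus :: "(real ^ 'd ^ 'n::finite) set" where
  "consensus = {x. \<forall>i j. x $ i = x $ j}"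

definition zero_sum :: "(real ^ 'd ^ 'n::finite) set" where
  "zero_sum = {w. (\<Sum>i\<in>UNIV. w $ i) = 0}"

lemma zero_sum_eq_orthogonal_comp:
  "(zero_sum :: (real ^ 'd ^ 'n::finite) set) = consensus\<^sup>\<bottom>"
proof (intro set_eqI iffI)
  fix w :: "real ^ 'd ^ 'n"
  assume w: "w \<in> zero_sum"
  have "x \<bullet> w = 0" if x: "x \<in> consensus" for x :: "real ^ 'd ^ 'n"
  proof -
    fix j :: 'n
    have "x \<bullet> w = (\<Sum>i\<in>UNIV. x $ j \<bullet> w $ i)"
      unfolding inner_vec_def using x by (auto simp: consensus_def intro!: sum.cong) metis
    also have "\<dots> = x $ j \<bullet> (\<Sum>i\<in>UNIV. w $ i)"
      by (simp add: inner_sum_right)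
    finally show ?thesis using w by (simp add: zero_sum_def)
  qed
  then show "w \<in> consensus\<^sup>\<bottom>"
    by (simp add: orthogonal_comp_def orthogonal_def)
next
  fix w :: "real ^ 'd ^ 'n"
  assume w: "w \<in> consensus\<^sup>\<bottom>"
  define s where "s = (\<Sum>i\<in>UNIV. w $ i)"
  have "(\<chi> i. s) \<bullet> w = 0"
    using w by (simp add: orthogonal_comp_def orthogonal_def consensus_def)
  then have "s \<bullet> s = 0"
    by (simp add: inner_vec_def[where 'b='n] s_def inner_sum_right)
  then show "w \<in> zero_sum" by (simp add: zero_sum_def s_def)
qed

definition orth_proj :: "'a::euclidean_space set \<Rightarrow> 'a \<Rightarrow> 'a" where
  "orth_proj U x = (THE p. p \<in> U \<and> x - p \<in> U\<^sup>\<bottom>)"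

definition primal_feasible :: "('n \<Rightarrow> (real ^ 'd) set) \<Rightarrow> (real ^ 'd ^ 'n::finite) set" where
  "primal_feasible X = {x \<in> consensus. \<forall>i. x $ i \<in> X i}"

definition primal_value ::
    "('n \<Rightarrow> real ^ 'd \<Rightarrow> real) \<Rightarrow> ('n::finite \<Rightarrow> (real ^ 'd) set) \<Rightarrow> real" where
  "primal_value f X = (INF x\<in>primal_feasible X. primal_obj f x)"

definition primal_sol ::
    "('n \<Rightarrow> real ^ 'd \<Rightarrow> real) \<Rightarrow> ('n::finite \<Rightarrow> (real ^ 'd) set) \<Rightarrow> real ^ 'd ^ 'n" where
  "primal_sol f X = (THE x. is_arg_min (primal_obj f) (\<lambda>x. x \<in> primal_feasible X) x)"

subsection \<open>Fenchel dual problem\<close>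

text \<open>
  The supremum is taken in the reals. It is finite whenever \<open>f\<close> is convex, \<open>X\<close> is nonempty and
  \<open>f\<close> is strongly convex over \<open>X\<close>, since \<open>f\<close> then dominates a quadratic on \<open>X\<close>.
\<close>

definition conjugate_over :: "(real ^ 'd \<Rightarrow> real) \<Rightarrow> (real ^ 'd) set \<Rightarrow> real ^ 'd \<Rightarrow> real" where
  "conjugate_over f X w = (SUP x\<in>X. w \<bullet> x - f x)"

definition dual_obj ::
    "('n \<Rightarrow> real ^ 'd \<Rightarrow> real) \<Rightarrow> ('n \<Rightarrow> (real ^ 'd) set) \<Rightarrow> real ^ 'd ^ 'n::finite \<Rightarrow> real" where
  "dual_obj f X w = (\<Sum>i\<in>UNIV. conjugate_over (f i) (X i) (w $ i))"

text \<open>\<open>LEAST\<close> rather than \<open>Inf\<close>: the dual optimal value is an attained minimum.\<close>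

definition dual_value ::
    "('n \<Rightarrow> real ^ 'd \<Rightarrow> real) \<Rightarrow> ('n::finite \<Rightarrow> (real ^ 'd) set) \<Rightarrow> real" where
  "dual_value f X = (LEAST m. m \<in> dual_obj f X ` zero_sum)"

subsection \<open>Networks and weight matrices\<close>

text \<open>An undirected graph on the nodes is given by its set of edges, each a two-element set.\<close>

definition simple_graph :: "'n set set \<Rightarrow> bool" where
  "simple_graph E \<longleftrightarrow> (\<forall>e\<in>E. card e = 2)"

definition connected_graph :: "'n set set \<Rightarrow> bool" where
  "connected_graph E \<longleftrightarrow> (\<forall>i j. (i, j) \<in> {(u, v). {u, v} \<in> E}\<^sup>*)"

definition neighbours :: "'n set set \<Rightarrow> 'n \<Rightarrow> 'n set" where
  "neighbours E i = {j. {i, j} \<in> E}"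

definition weight_matrix :: "'n set set \<Rightarrow> ('n \<Rightarrow> 'n \<Rightarrow> real) \<Rightarrow> real ^ 'n ^ 'n::finite" where
  "weight_matrix E h =
     (\<chi> i j. if i = j then \<Sum>s\<in>neighbours E i. h i s
             else if {i, j} \<in> E then - h i j
             else 0)"

definition diag_matrix :: "('n \<Rightarrow> real) \<Rightarrow> real ^ 'n ^ 'n::finite" where
  "diag_matrix l = (\<chi> i j. if i = j then l i else 0)"

definition pos_semidef :: "real ^ 'n ^ 'n::finite \<Rightarrow> bool" where
  "pos_semidef A \<longleftrightarrow> transpose A = A \<and> (\<forall>v. 0 \<le> v \<bullet> (A *v v))"

definition loewner_le :: "real ^ 'n ^ 'n::finite \<Rightarrow> real ^ 'n ^ 'n \<Rightarrow> bool"
    (infix "\<preceq>" 50) where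
  "M \<preceq> M' \<longleftrightarrow> pos_semidef (M' - M)"

subsection \<open>The Fenchel dual gradient method\<close>

definition fenchel_dual_gradient_method ::
    "('n \<Rightarrow> real ^ 'd \<Rightarrow> real) \<Rightarrow> ('n \<Rightarrow> (real ^ 'd) set) \<Rightarrow>
     (nat \<Rightarrow> 'n set set) \<Rightarrow> (nat \<Rightarrow> 'n \<Rightarrow> 'n \<Rightarrow> real) \<Rightarrow> (nat \<Rightarrow> real) \<Rightarrow>
     (nat \<Rightarrow> real ^ 'd ^ 'n::finite) \<Rightarrow> (nat \<Rightarrow> real ^ 'd ^ 'n) \<Rightarrow> bool" where
  "fenchel_dual_gradient_method f X E h \<alpha> w x \<longleftrightarrow>
     w 0 \<in> zero_sum \<and>
     (\<forall>k i. is_arg_max (\<lambda>z. w k $ i \<bullet> z - f i z) (\<lambda>z. z \<in> X i) (x k $ i)) \<and>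
     (\<forall>k i. w (Suc k) $ i =
        w k $ i - \<alpha> k *\<^sub>R (\<Sum>j\<in>neighbours (E k) i. h k i j *\<^sub>R (x k $ i - x k $ j)))"

end

theory Submission
  imports Defs
begin

text \<open>
  The method is gradient descent on the dual objective \<open>D\<close>, preconditioned by the graph Laplacian
  \<open>H\<close> of the current network: strong convexity makes \<open>D\<close> differentiable with gradient
  \<open>(x\<^sub>1, \<dots>, x\<^sub>n)\<close> at \<open>w\<close>, the blocks \<open>x\<^sub>i\<close> being the maximizers that define the conjugates, and
  the update is \<open>w - \<alpha> H x\<close>. Two inequalities take the place of differentiability. The descent
  inequality (\<open>dual_obj_descent\<close>) bounds \<open>D\<close> from above by a quadratic; together with
  \<open>H \<preceq> \<delta> \<Lambda>\<inverse>\<close> and \<open>\<alpha> < 2 / \<delta>\<close> it shows that \<open>D\<close> decreases in every step by at least a fixed multiple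
  of the disagreement \<open>x \<bullet> H x\<close>. The growth inequality (\<open>dual_obj_growth\<close>) bounds \<open>D\<close> from below by its
  linearization plus a quadratic in the primal iterates, \<open>D w \<ge> D w' + x' \<bullet> (w - w') + \<Sum>\<^sub>i \<theta>\<^sub>i / 2
  \<parallel>x\<^sub>i - x'\<^sub>i\<parallel>\<^sup>2\<close>, and so turns information about dual values into closeness of primal iterates.

  Since all \<open>X\<^sub>i\<close> contain a common ball around the origin, sublevel sets of \<open>D\<close> are bounded. Hence
  \<open>D\<close> converges along the iterates, the disagreement tends to zero, so that the endpoints of active
  edges come arbitrarily close, and the pairs \<open>(w, x)\<close> have a limit point \<open>(w', x')\<close>.

  The crux is that \<open>x'\<close> is a consensus (\<open>limit_consensus\<close>). An edge may be inactive for arbitrarily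
  long periods, so a small disagreement says nothing about the inactive edges. Suppose that \<open>x'\<close> takes
  several values. While the primal iterate is near \<open>x'\<close>, a late active edge can only join nodes with
  the same value of \<open>x'\<close>, and then the step is orthogonal to \<open>x'\<close>, so that \<open>x' \<bullet> w\<close> does not change.
  But as long as \<open>x' \<bullet> w\<close> does not change, the growth inequality keeps the primal iterate near \<open>x'\<close>,
  because \<open>D w\<close> is already near \<open>D w'\<close> and \<open>x' \<bullet> w\<close> was near \<open>x' \<bullet> w'\<close> to begin with. So the iterate never gets away, and no edge between different
  values of \<open>x'\<close> is ever active again. This contradicts connectivity of the infinitely often
  active edges.

  A consensus \<open>x'\<close> of maximizers at some \<open>w'\<close> with zero block sum is a saddle point, so \<open>x'\<close> is the
  primal solution and \<open>D w'\<close> the dual optimal value. The linear term of the growth inequality now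
  vanishes for all iterates, so convergence of the dual values forces convergence of the whole
  primal sequence.
\<close>

section \<open>Strong convexity and maximizers\<close>

text \<open>
  A hyperplane separates the point \<open>(x, f x)\<close> from the strict epigraph. It is not vertical because
  \<open>f\<close> is finite everywhere, so its slope is a subgradient.
\<close>

lemma convex_subgradient_exists:
  fixes f :: "real ^ 'd \<Rightarrow> real"
  assumes "convex_on UNIV f"
  shows "\<exists>g. subgradient f x g"
proof -
  let ?S = "{(x, f x)} :: ((real ^ 'd) \<times> real) set" and ?T = "{(y, s). f y < s}"
  have "convex ?T"
  proof (rule convexI)
    fix p q :: "(real ^ 'd) \<times> real" and u v :: real
    assume pq: "p \<in> ?T" "q \<in> ?T" and uv: "0 \<le> u" "0 \<le> v" "u + v = 1"
    obtain y s y' s' where pq': "p = (y, s)" "q = (y', s')" by fastforce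
    have "f (u *\<^sub>R y + v *\<^sub>R y') \<le> u * f y + v * f y'"
      using assms uv unfolding convex_on_def by auto
    also have "\<dots> < u * s + v * s'"
    proof (cases "u = 0")
      case True
      then show ?thesis using uv pq pq' by auto
    next
      case False
      then have "u * f y < u * s" "v * f y' \<le> v * s'"
        using uv pq pq' by (auto intro!: mult_left_mono)
      then show ?thesis by linarith
    qed
    finally show "u *\<^sub>R p + v *\<^sub>R q \<in> ?T" by (simp add: pq')
  qed
  moreover have "(x, f x + 1) \<in> ?T" by simp
  then have "?T \<noteq> {}" by blast
  moreover have "?S \<inter> ?T = {}" by auto
  ultimately obtain a b where a: "a \<noteq> 0" and S: "\<forall>z\<in>?S. a \<bullet> z \<le> b" and T: "\<forall>z\<in>?T. a \<bullet> z \<ge> b"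
    using separating_hyperplane_sets[of ?S ?T] by auto
  obtain p c where pc: "a = (p, c)" by fastforce
  have sep: "p \<bullet> x + c * f x \<le> p \<bullet> y + c * s" if "f y < s" for y s
    using S T that pc by (fastforce intro: order_trans)
  \<comment> \<open>A vertical hyperplane would have to separate \<open>x\<close> from the whole space; \<open>x - p\<close> refutes this.\<close>
  have "c \<noteq> 0"
  proof
    assume "c = 0"
    then have "p \<bullet> x \<le> p \<bullet> (x - p)" using sep[of "x - p" "f (x - p) + 1"] by simp
    then have "p \<bullet> p \<le> 0" by (simp add: inner_diff_right)
    then have "p = 0" by (metis inner_eq_zero_iff inner_ge_zero order_antisym)
    then show False using a pc \<open>c = 0\<close> by (simp add: zero_prod_def)
  qed
  moreover have "c \<ge> 0" using sep[of x "f x + 1"] by (simp add: algebra_simps)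
  ultimately have c: "c > 0" by simp
  have "f y - f x - ((- 1 / c) *\<^sub>R p) \<bullet> (y - x) \<ge> 0" for y
  proof -
    have "p \<bullet> x / c + f x - p \<bullet> y / c \<le> s" if "f y < s" for s
    proof -
      have "(p \<bullet> x + c * f x) / c \<le> (p \<bullet> y + c * s) / c"
        using sep[OF that] c by (intro divide_right_mono) auto
      then show ?thesis using c by (simp add: add_divide_distrib)
    qed
    then have "p \<bullet> x / c + f x - p \<bullet> y / c \<le> f y"
      by (rule dense_ge)
    then show ?thesis by (simp add: inner_diff_right diff_divide_distrib)
  qed
  then show ?thesis unfolding subgradient_def by blast
qed

text \<open>
  Strong convexity as defined speaks about subgradients; this is its subgradient-free form, obtained
  by adding the inequalities towards both endpoints for one subgradient at the intermediate
  point, with weights that cancel the linear terms. Optimality of a constrained maximizer compares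
  function values, so this is the form that it can be combined with.
\<close>

lemma strongly_convex_over_segment:
  fixes f :: "real ^ 'd \<Rightarrow> real"
  assumes f: "convex_on UNIV f" and X: "convex X" and sc: "strongly_convex_over f X \<theta>"
    and xy: "x \<in> X" "y \<in> X" and t: "0 \<le> t" "t \<le> 1"
  shows "f (x + t *\<^sub>R (y - x)) + \<theta> / 2 * (t * (1 - t)) * (norm (y - x))\<^sup>2 \<le> (1 - t) * f x + t * f y"
proof -
  define z where "z = x + t *\<^sub>R (y - x)"
  have "z = (1 - t) *\<^sub>R x + t *\<^sub>R y" by (simp add: z_def algebra_simps)
  then have z: "z \<in> X" using convexD_alt[OF X xy t] by simp
  obtain g where g: "subgradient f z g" using convex_subgradient_exists[OF f] by blast
  have zx: "x - z = (- t) *\<^sub>R (y - x)" and zy: "y - z = (1 - t) *\<^sub>R (y - x)"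
    by (auto simp: z_def algebra_simps)
  have 1: "f x - f z - g \<bullet> (x - z) \<ge> \<theta> * (norm (x - z))\<^sup>2 / 2"
    and 2: "f y - f z - g \<bullet> (y - z) \<ge> \<theta> * (norm (y - z))\<^sup>2 / 2"
    using sc g z xy unfolding strongly_convex_over_def by blast+
  have 1: "f x - f z + t * (g \<bullet> (y - x)) \<ge> \<theta> * (t\<^sup>2 * (norm (y - x))\<^sup>2) / 2"
    using 1 unfolding zx by (simp add: power_mult_distrib)
  have 2: "f y - f z - (1 - t) * (g \<bullet> (y - x)) \<ge> \<theta> * ((1 - t)\<^sup>2 * (norm (y - x))\<^sup>2) / 2"
    using 2 unfolding zy by (simp add: power_mult_distrib)
  have "(1 - t) * (\<theta> * (t\<^sup>2 * (norm (y - x))\<^sup>2) / 2) \<le> (1 - t) * (f x - f z + t * (g \<bullet> (y - x)))"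
    and "t * (\<theta> * ((1 - t)\<^sup>2 * (norm (y - x))\<^sup>2) / 2) \<le> t * (f y - f z - (1 - t) * (g \<bullet> (y - x)))"
    using mult_left_mono[OF 1, of "1 - t"] mult_left_mono[OF 2, of t] t by auto
  then show ?thesis
    unfolding z_def[symmetric] by (simp add: field_simps power2_eq_square)
qed

text \<open>
  Optimality of \<open>x\<close> against the points of the segment towards \<open>y\<close>, divided by the
  parameter \<open>t\<close> and taken to the limit \<open>t \<rightarrow> 0\<close>. All estimates for the conjugates rest on this
  inequality.
\<close>

lemma argmax_quadratic_growth:
  fixes f :: "real ^ 'd \<Rightarrow> real"
  assumes f: "convex_on UNIV f" and X: "convex X" and sc: "strongly_convex_over f X \<theta>"
    and x: "is_arg_max (\<lambda>z. w \<bullet> z - f z) (\<lambda>z. z \<in> X) x" and y: "y \<in> X"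
  shows "f x + w \<bullet> (y - x) + \<theta> / 2 * (norm (y - x))\<^sup>2 \<le> f y"
proof -
  have xX: "x \<in> X" and mx: "\<And>z. z \<in> X \<Longrightarrow> w \<bullet> z - f z \<le> w \<bullet> x - f x"
    using x by (auto simp: is_arg_max_def not_less)
  have "w \<bullet> (y - x) + \<theta> / 2 * (1 - t) * (norm (y - x))\<^sup>2 \<le> f y - f x"
    if t: "t \<in> {0<..<1}" for t
  proof -
    have "x + t *\<^sub>R (y - x) = (1 - t) *\<^sub>R x + t *\<^sub>R y" by (simp add: algebra_simps)
    then have "x + t *\<^sub>R (y - x) \<in> X" using convexD_alt[OF X xX y, of t] t by simp
    from mx[OF this] have "t * (w \<bullet> (y - x)) \<le> f (x + t *\<^sub>R (y - x)) - f x"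
      by (simp add: inner_add_right)
    moreover have "f (x + t *\<^sub>R (y - x)) + \<theta> / 2 * (t * (1 - t)) * (norm (y - x))\<^sup>2
        \<le> (1 - t) * f x + t * f y"
      using strongly_convex_over_segment[OF f X sc xX y] t by simp
    ultimately have "t * (w \<bullet> (y - x) + \<theta> / 2 * (1 - t) * (norm (y - x))\<^sup>2) \<le> t * (f y - f x)"
      by (simp add: algebra_simps)
    then show ?thesis using t by simp
  qed
  then have ev: "\<forall>\<^sub>F t in at_right 0.
      w \<bullet> (y - x) + \<theta> / 2 * (1 - t) * (norm (y - x))\<^sup>2 \<le> f y - f x"
    using eventually_at_right_field[of _ "0::real"] by (auto intro!: exI[of _ "1::real"])
  have "((\<lambda>t. w \<bullet> (y - x) + \<theta> / 2 * (1 - t) * (norm (y - x))\<^sup>2) \<longlongrightarrow>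
      w \<bullet> (y - x) + \<theta> / 2 * (1 - 0) * (norm (y - x))\<^sup>2) (at_right 0)"
    by (intro tendsto_intros)
  from tendsto_upperbound[OF this ev] show ?thesis by simp
qed

lemma inner_minus_square_le:
  fixes a b :: "'a::real_inner"
  assumes "\<theta> > 0"
  shows "a \<bullet> b - \<theta> / 2 * (norm b)\<^sup>2 \<le> (norm a)\<^sup>2 / (2 * \<theta>)"
proof -
  have "0 \<le> (norm (a - \<theta> *\<^sub>R b))\<^sup>2" by simp
  also have "\<dots> = (norm a)\<^sup>2 - 2 * \<theta> * (a \<bullet> b) + \<theta>\<^sup>2 * (norm b)\<^sup>2"
    unfolding power2_norm_eq_inner
    by (simp add: inner_diff inner_commute[of b a] power2_eq_square algebra_simps del: dot_square_norm)
  finally show ?thesis using assms by (simp add: field_simps power2_eq_square)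
qed

text \<open>
  Adding the growth inequalities of both maximizers, each tested at the other one, shows that
  the maximizer depends on \<open>w\<close> with Lipschitz constant \<open>1 / \<theta>\<close>. It is needed because a bounded
  sequence of dual points must yield bounded primal points although \<open>X\<close> may be unbounded.
\<close>

lemma argmax_lipschitz:
  fixes f :: "real ^ 'd \<Rightarrow> real"
  assumes f: "convex_on UNIV f" and X: "convex X" and sc: "strongly_convex_over f X \<theta>"
    and x: "is_arg_max (\<lambda>z. w \<bullet> z - f z) (\<lambda>z. z \<in> X) x"
    and x': "is_arg_max (\<lambda>z. w' \<bullet> z - f z) (\<lambda>z. z \<in> X) x'"
  shows "norm (x - x') \<le> norm (w - w') / \<theta>"
proof -
  have \<theta>: "\<theta> > 0" using sc by (simp add: strongly_convex_over_def)
  have "x \<in> X" "x' \<in> X" using x x' by (auto simp: is_arg_max_def)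
  then have "f x + w \<bullet> (x' - x) + \<theta> / 2 * (norm (x' - x))\<^sup>2 \<le> f x'"
    and "f x' + w' \<bullet> (x - x') + \<theta> / 2 * (norm (x - x'))\<^sup>2 \<le> f x"
    using argmax_quadratic_growth[OF f X sc] x x' by blast+
  then have "\<theta> * (norm (x - x'))\<^sup>2 \<le> (w - w') \<bullet> (x - x')"
    by (simp add: norm_minus_commute algebra_simps)
  also have "\<dots> \<le> norm (w - w') * norm (x - x')" by (rule norm_cauchy_schwarz)
  finally have "(\<theta> * norm (x - x')) * norm (x - x') \<le> norm (w - w') * norm (x - x')"
    by (simp add: power2_eq_square mult.assoc)
  then have "\<theta> * norm (x - x') \<le> norm (w - w')"
    by (cases "x = x'") (auto simp: mult_le_cancel_right)
  then show ?thesis using \<theta> by (simp add: field_simps)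
qed

section \<open>The conjugate functions\<close>

lemma conjugate_over_eq:
  assumes "is_arg_max (\<lambda>z. w \<bullet> z - f z) (\<lambda>z. z \<in> X) x"
  shows "conjugate_over f X w = w \<bullet> x - f x"
  unfolding conjugate_over_def using assms
  by (intro cSup_eq_maximum) (auto simp: is_arg_max_def not_less)

text \<open>
  Bounding the supremum termwise serves twice: it yields the descent inequality below, and it shows
  that the supremum over \<open>X\<close> is finite at every \<open>w'\<close>, also where no maximizer is at hand.
\<close>

lemma argmax_value_le:
  fixes f :: "real ^ 'd \<Rightarrow> real"
  assumes f: "convex_on UNIV f" and X: "convex X" and sc: "strongly_convex_over f X \<theta>"
    and x: "is_arg_max (\<lambda>z. w \<bullet> z - f z) (\<lambda>z. z \<in> X) x" and y: "y \<in> X"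
  shows "w' \<bullet> y - f y \<le> conjugate_over f X w + (w' - w) \<bullet> x + (norm (w' - w))\<^sup>2 / (2 * \<theta>)"
proof -
  have \<theta>: "\<theta> > 0" using sc by (simp add: strongly_convex_over_def)
  have "f x + w \<bullet> (y - x) + \<theta> / 2 * (norm (y - x))\<^sup>2 \<le> f y"
    using argmax_quadratic_growth[OF f X sc x y] .
  moreover have "(w' - w) \<bullet> (y - x) - \<theta> / 2 * (norm (y - x))\<^sup>2 \<le> (norm (w' - w))\<^sup>2 / (2 * \<theta>)"
    using inner_minus_square_le[OF \<theta>] .
  ultimately show ?thesis
    unfolding conjugate_over_eq[OF x] by (simp add: algebra_simps)
qed

lemma conjugate_over_descent:
  fixes f :: "real ^ 'd \<Rightarrow> real"
  assumes f: "convex_on UNIV f" and X: "convex X" and sc: "strongly_convex_over f X \<theta>"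
    and x: "is_arg_max (\<lambda>z. w \<bullet> z - f z) (\<lambda>z. z \<in> X) x"
  shows "conjugate_over f X w' \<le>
    conjugate_over f X w + (w' - w) \<bullet> x + (norm (w' - w))\<^sup>2 / (2 * \<theta>)"
proof -
  have "X \<noteq> {}" using x by (auto simp: is_arg_max_def)
  then show ?thesis
    unfolding conjugate_over_def[of f X w'] using argmax_value_le[OF assms]
    by (intro cSUP_least) auto
qed

lemma conjugate_over_ge:
  fixes f :: "real ^ 'd \<Rightarrow> real"
  assumes f: "convex_on UNIV f" and X: "convex X" and sc: "strongly_convex_over f X \<theta>"
    and x: "is_arg_max (\<lambda>z. w \<bullet> z - f z) (\<lambda>z. z \<in> X) x" and y: "y \<in> X"
  shows "w' \<bullet> y - f y \<le> conjugate_over f X w'"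
  unfolding conjugate_over_def using argmax_value_le[OF f X sc x] y
  by (intro cSUP_upper bdd_aboveI2) auto

section \<open>Primal-dual pairs\<close>

lemma inner_blocks: "x \<bullet> y = (\<Sum>i\<in>UNIV. x $ i \<bullet> y $ i)" for x y :: "real ^ 'd ^ 'n::finite"
  by (rule inner_vec_def)

definition primal_argmax ::
    "('n \<Rightarrow> real ^ 'd \<Rightarrow> real) \<Rightarrow> ('n \<Rightarrow> (real ^ 'd) set) \<Rightarrow>
     real ^ 'd ^ 'n::finite \<Rightarrow> real ^ 'd ^ 'n \<Rightarrow> bool" where
  "primal_argmax f X w x \<longleftrightarrow>
     (\<forall>i. is_arg_max (\<lambda>z. w $ i \<bullet> z - f i z) (\<lambda>z. z \<in> X i) (x $ i))"

lemma primal_argmax_mem: "primal_argmax f X w x \<Longrightarrow> x $ i \<in> X i"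
  by (simp add: primal_argmax_def is_arg_max_def)

lemma dual_obj_eq:
  assumes "primal_argmax f X w x"
  shows "dual_obj f X w = w \<bullet> x - primal_obj f x"
proof -
  have "conjugate_over (f i) (X i) (w $ i) = w $ i \<bullet> x $ i - f i (x $ i)" for i
    using assms by (intro conjugate_over_eq) (simp add: primal_argmax_def)
  then show ?thesis
    by (simp add: dual_obj_def primal_obj_def inner_blocks sum_subtractf)
qed

text \<open>
  The maximizer relation is closed, so limit points of the iterates are again primal-dual
  pairs and continuity of the conjugates never has to be discussed.
\<close>

lemma primal_argmax_limit:
  assumes "\<And>i. continuous_on UNIV (f i)" "\<And>i. closed (X i)"
    and pa: "\<And>k. primal_argmax f X (w k) (x k)"
    and lim: "w \<longlonglongrightarrow> w'" "x \<longlonglongrightarrow> x'"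
  shows "primal_argmax f X w' x'"
  unfolding primal_argmax_def is_arg_max_def
proof (intro allI conjI notI; (elim exE conjE)?)
  fix i
  have xi: "(\<lambda>k. x k $ i) \<longlonglongrightarrow> x' $ i" using lim(2) by (rule tendsto_vec_nth)
  have wi: "(\<lambda>k. w k $ i) \<longlonglongrightarrow> w' $ i" using lim(1) by (rule tendsto_vec_nth)
  show "x' $ i \<in> X i"
    using closed_sequentially[OF assms(2) _ xi] primal_argmax_mem[OF pa] by blast
  fix z assume z: "z \<in> X i" "w' $ i \<bullet> x' $ i - f i (x' $ i) < w' $ i \<bullet> z - f i z"
  have "(\<lambda>k. f i (x k $ i)) \<longlonglongrightarrow> f i (x' $ i)"
    using continuous_on_tendsto_compose[OF assms(1) xi] by simp
  then have "(\<lambda>k. w k $ i \<bullet> x k $ i - f i (x k $ i)) \<longlonglongrightarrow> w' $ i \<bullet> x' $ i - f i (x' $ i)"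
    by (intro tendsto_intros xi wi)
  moreover have "(\<lambda>k. w k $ i \<bullet> z - f i z) \<longlonglongrightarrow> w' $ i \<bullet> z - f i z"
    by (intro tendsto_intros wi)
  moreover have "w k $ i \<bullet> z - f i z \<le> w k $ i \<bullet> x k $ i - f i (x k $ i)" for k
    using pa z(1) by (auto simp: primal_argmax_def is_arg_max_def not_less)
  ultimately have "w' $ i \<bullet> z - f i z \<le> w' $ i \<bullet> x' $ i - f i (x' $ i)"
    by (intro LIMSEQ_le) auto
  then show False using z(2) by simp
qed

lemma inner_consensus_zero_sum: "w \<in> zero_sum \<Longrightarrow> x \<in> consensus \<Longrightarrow> w \<bullet> x = 0"
  for w x :: "real ^ 'd ^ 'n"
  by (auto simp: zero_sum_eq_orthogonal_comp orthogonal_comp_def orthogonal_def inner_commute)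

lemma orth_proj_zero_sum:
  fixes x :: "real ^ 'd ^ 'n::finite"
  shows "orth_proj zero_sum x = x - (\<chi> i. (\<Sum>j\<in>UNIV. x $ j) /\<^sub>R CARD('n))"
  (is "_ = x - ?m")
  unfolding orth_proj_def
proof (rule the_equality)
  have m: "?m \<in> zero_sum\<^sup>\<bottom>"
    unfolding orthogonal_comp_def orthogonal_def
  proof (intro CollectI ballI)
    fix y :: "real ^ 'd ^ 'n" assume "y \<in> zero_sum"
    moreover have "?m \<in> consensus" by (simp add: consensus_def)
    ultimately show "y \<bullet> ?m = 0"
      by (auto simp: zero_sum_eq_orthogonal_comp orthogonal_comp_def orthogonal_def inner_commute)
  qed
  have z: "x - ?m \<in> zero_sum"
    by (simp add: zero_sum_def sum_subtractf sum_constant_scaleR del: sum_constant)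
  show "x - ?m \<in> zero_sum \<and> x - (x - ?m) \<in> zero_sum\<^sup>\<bottom>"
    using z m by simp
  fix p :: "real ^ 'd ^ 'n" assume p: "p \<in> zero_sum \<and> x - p \<in> zero_sum\<^sup>\<bottom>"
  define e where "e = p - (x - ?m)"
  have e: "e \<in> zero_sum"
    using p z by (simp add: e_def zero_sum_def sum_subtractf)
  then have "e \<bullet> (x - p) = 0" "e \<bullet> ?m = 0"
    using p m by (auto simp: orthogonal_comp_def orthogonal_def)
  moreover have "e = ?m - (x - p)" by (simp add: e_def)
  ultimately have "e \<bullet> e = 0" by (metis diff_self inner_diff_right)
  then show "p = x - ?m" by (simp add: e_def)
qed

locale strongly_convex_family =
  fixes f :: "'n::finite \<Rightarrow> real ^ 'd \<Rightarrow> real"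
    and X :: "'n \<Rightarrow> (real ^ 'd) set"
    and \<theta> :: "'n \<Rightarrow> real"
  assumes convex_f: "\<And>i. convex_on UNIV (f i)"
    and convex_X: "\<And>i. convex (X i)"
    and strongly_convex: "\<And>i. strongly_convex_over (f i) (X i) (\<theta> i)"
begin

lemma theta_pos: "\<theta> i > 0"
  using strongly_convex[of i] by (simp add: strongly_convex_over_def)

lemma continuous_f: "continuous_on UNIV (f i)"
  by (rule convex_on_continuous[OF open_UNIV convex_f])

lemma tendsto_primal_obj: "y \<longlonglongrightarrow> z \<Longrightarrow> (\<lambda>k. primal_obj f (y k)) \<longlonglongrightarrow> primal_obj f z"
  unfolding primal_obj_def
  by (intro tendsto_sum continuous_on_tendsto_compose[OF continuous_f] tendsto_vec_nth) auto

lemma primal_obj_growth: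
  assumes "primal_argmax f X w x" "\<And>i. y $ i \<in> X i"
  shows "primal_obj f x + w \<bullet> (y - x) + (\<Sum>i\<in>UNIV. \<theta> i / 2 * (norm (y $ i - x $ i))\<^sup>2)
    \<le> primal_obj f y"
  unfolding primal_obj_def inner_blocks sum.distrib[symmetric]
  using argmax_quadratic_growth[OF convex_f convex_X strongly_convex] assms
  by (intro sum_mono) (simp add: primal_argmax_def)

lemma dual_obj_growth:
  assumes "primal_argmax f X w x" "primal_argmax f X w' x'"
  shows "dual_obj f X w' + x' \<bullet> (w - w') + (\<Sum>i\<in>UNIV. \<theta> i / 2 * (norm (x $ i - x' $ i))\<^sup>2)
    \<le> dual_obj f X w"
  using primal_obj_growth[OF assms(1), of x'] primal_argmax_mem[OF assms(2)]
  by (simp add: dual_obj_eq[OF assms(1)] dual_obj_eq[OF assms(2)] inner_diff_right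
      inner_commute norm_minus_commute)

lemma dual_obj_descent:
  assumes "primal_argmax f X w x"
  shows "dual_obj f X w' \<le> dual_obj f X w + (w' - w) \<bullet> x
    + (\<Sum>i\<in>UNIV. (norm (w' $ i - w $ i))\<^sup>2 / (2 * \<theta> i))"
  unfolding dual_obj_def inner_blocks sum.distrib[symmetric]
  using conjugate_over_descent[OF convex_f convex_X strongly_convex] assms
  by (intro sum_mono) (simp add: primal_argmax_def)

lemma dual_obj_ge:
  assumes "primal_argmax f X w x" "\<And>i. y $ i \<in> X i"
  shows "w' \<bullet> y - primal_obj f y \<le> dual_obj f X w'"
  unfolding dual_obj_def inner_blocks primal_obj_def sum_subtractf[symmetric]
  using assms
  by (intro sum_mono conjugate_over_ge[OF convex_f convex_X strongly_convex])
    (auto simp: primal_argmax_def)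

lemma primal_argmax_bounded:
  assumes "\<And>k::nat. primal_argmax f X (w k) (x k)" "bounded (range w)"
  shows "bounded (range x)"
proof -
  obtain B where B: "\<And>k. norm (w k) \<le> B" using assms(2) by (auto simp: bounded_iff)
  have "norm (x k) \<le> (\<Sum>i\<in>UNIV. 2 * B / \<theta> i + norm (x 0 $ i))" for k
  proof -
    have "norm (x k $ i) \<le> 2 * B / \<theta> i + norm (x 0 $ i)" for i
    proof -
      have "norm (x k $ i - x 0 $ i) \<le> norm (w k $ i - w 0 $ i) / \<theta> i"
        using argmax_lipschitz[OF convex_f convex_X strongly_convex] assms(1)
        by (simp add: primal_argmax_def)
      also have "norm (w k $ i - w 0 $ i) \<le> norm (w k) + norm (w 0)"
        using Finite_Cartesian_Product.norm_nth_le[of "w k" i]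
            Finite_Cartesian_Product.norm_nth_le[of "w 0" i] norm_triangle_ineq4[of "w k $ i" "w 0 $ i"]
        by linarith
      also have "\<dots> \<le> 2 * B" using B[of k] B[of 0] by simp
      finally have "norm (x k $ i - x 0 $ i) \<le> 2 * B / \<theta> i"
        using theta_pos[of i] by (simp add: divide_right_mono)
      then show ?thesis using norm_triangle_sub[of "x k $ i" "x 0 $ i"] by linarith
    qed
    then have "(\<Sum>i\<in>UNIV. norm (x k $ i)) \<le> (\<Sum>i\<in>UNIV. 2 * B / \<theta> i + norm (x 0 $ i))"
      by (intro sum_mono)
    then show ?thesis using L2_set_le_sum[of UNIV "\<lambda>i. norm (x k $ i)"]
      by (simp add: norm_vec_def)
  qed
  then show ?thesis by (auto simp: bounded_iff)
qed

text \<open>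
  Testing the conjugate at a point of norm \<open>r\<close> in the direction of the dual block shows that \<open>D\<close>
  grows at least like \<open>r \<parallel>w\<parallel>\<close>, provided that the ball of radius \<open>r\<close> lies in every \<open>X\<^sub>i\<close>.
\<close>

lemma dual_sublevel_bounded:
  assumes int: "0 \<in> interior (\<Inter>i. X i)"
    and pa: "\<And>k. primal_argmax f X (w k) (x k)" and D: "\<And>k. dual_obj f X (w k) \<le> c"
  shows "bounded (range w)"
proof -
  obtain r where r: "r > 0" "cball 0 r \<subseteq> (\<Inter>i. X i)"
    using int by (auto simp: mem_interior_cball)
  have "\<exists>M. \<forall>z\<in>cball 0 r. f i z \<le> M" for i
  proof -
    have "compact (f i ` cball 0 r)"
      by (intro compact_continuous_image continuous_on_subset[OF continuous_f]) auto
    then have "bdd_above (f i ` cball 0 r)"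
      by (simp add: compact_imp_bounded bounded_imp_bdd_above)
    then show ?thesis by (auto simp: bdd_above_def)
  qed
  then obtain M where M: "\<And>i z. z \<in> cball 0 r \<Longrightarrow> f i z \<le> M i" by metis
  have "norm (w k) \<le> (c + (\<Sum>i\<in>UNIV. M i)) / r" for k
  proof -
    define y :: "real ^ 'd ^ 'n" where "y = (\<chi> i. r *\<^sub>R sgn (w k $ i))"
    have y: "y $ i \<in> cball 0 r" for i using r by (simp add: y_def norm_sgn)
    have "r * norm (w k) \<le> r * (\<Sum>i\<in>UNIV. norm (w k $ i))"
      using L2_set_le_sum[of UNIV "\<lambda>i. norm (w k $ i)"] r by (simp add: norm_vec_def)
    also have "\<dots> = w k \<bullet> y"
    proof -
      have "w k $ i \<bullet> y $ i = r * norm (w k $ i)" for i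
        by (cases "w k $ i = 0")
          (simp_all add: y_def sgn_div_norm dot_square_norm power2_eq_square)
      then show ?thesis by (simp add: inner_blocks sum_distrib_left)
    qed
    also have "\<dots> \<le> dual_obj f X (w k) + primal_obj f y"
      using dual_obj_ge[OF pa, of y "w k"] y r(2) by fastforce
    also have "\<dots> \<le> c + (\<Sum>i\<in>UNIV. M i)"
      unfolding primal_obj_def using D M y by (intro add_mono sum_mono) auto
    finally show ?thesis using r by (simp add: field_simps)
  qed
  then show ?thesis by (auto simp: bounded_iff)
qed

text \<open>
  A maximizing pair with \<open>w \<in> zero_sum\<close> and \<open>x \<in> consensus\<close> is a saddle point of the Lagrangian: the
  inner products of feasible points vanish, so the growth inequality certifies optimality of \<open>x\<close>
  (with uniqueness) and weak duality certifies optimality of \<open>w\<close>.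
\<close>

context
  fixes w x :: "real ^ 'd ^ 'n"
  assumes pa: "primal_argmax f X w x" and w: "w \<in> zero_sum" and x: "x \<in> consensus"
begin

lemma saddle_feasible: "x \<in> primal_feasible X"
  using x primal_argmax_mem[OF pa] by (simp add: primal_feasible_def)

lemma saddle_primal_growth:
  assumes "y \<in> primal_feasible X"
  shows "primal_obj f x + (\<Sum>i\<in>UNIV. \<theta> i / 2 * (norm (y $ i - x $ i))\<^sup>2) \<le> primal_obj f y"
  using primal_obj_growth[OF pa, of y] assms inner_consensus_zero_sum[OF w] x
  by (auto simp: primal_feasible_def inner_diff_right)

lemma saddle_primal_le: "y \<in> primal_feasible X \<Longrightarrow> primal_obj f x \<le> primal_obj f y"
  using saddle_primal_growth[of y] theta_pos
  by (smt (verit) sum_nonneg divide_nonneg_pos mult_nonneg_nonneg zero_le_power2)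

lemma saddle_primal_value: "primal_value f X = primal_obj f x"
  unfolding primal_value_def using saddle_feasible saddle_primal_le
  by (intro cInf_eq_minimum) auto

lemma saddle_primal_sol: "primal_sol f X = x"
  unfolding primal_sol_def
proof (rule the_equality)
  show "is_arg_min (primal_obj f) (\<lambda>x. x \<in> primal_feasible X) x"
    using saddle_feasible saddle_primal_le by (auto simp: is_arg_min_def not_less)
next
  fix y assume y: "is_arg_min (primal_obj f) (\<lambda>x. x \<in> primal_feasible X) y"
  then have "y \<in> primal_feasible X" "primal_obj f y \<le> primal_obj f x"
    using saddle_feasible by (auto simp: is_arg_min_def not_less)
  then have "(\<Sum>i\<in>UNIV. \<theta> i / 2 * (norm (y $ i - x $ i))\<^sup>2) \<le> 0"
    using saddle_primal_growth[of y] by simp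
  moreover have nonneg: "\<theta> i / 2 * (norm (y $ i - x $ i))\<^sup>2 \<ge> 0" for i
    using theta_pos[of i] by simp
  ultimately have "(\<Sum>i\<in>UNIV. \<theta> i / 2 * (norm (y $ i - x $ i))\<^sup>2) = 0"
    by (meson order_antisym sum_nonneg)
  then have "\<theta> i / 2 * (norm (y $ i - x $ i))\<^sup>2 = 0" for i
    using nonneg by (simp add: sum_nonneg_eq_0_iff)
  then have "\<theta> i = 0 \<or> y $ i = x $ i" for i by simp
  then have "y $ i = x $ i" for i using theta_pos[of i] by (metis less_irrefl)
  then show "y = x" by (simp add: vec_eq_iff)
qed

lemma saddle_dual_value: "dual_value f X = dual_obj f X w"
  unfolding dual_value_def
proof (rule Least_equality)
  show "dual_obj f X w \<in> dual_obj f X ` zero_sum" using w by simp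
next
  fix m assume "m \<in> dual_obj f X ` zero_sum"
  then obtain w' where w': "w' \<in> zero_sum" "m = dual_obj f X w'" by blast
  have "w' \<bullet> x - primal_obj f x \<le> m"
    using dual_obj_ge[OF pa, of x] primal_argmax_mem[OF pa] w' by blast
  then show "dual_obj f X w \<le> m"
    using dual_obj_eq[OF pa] inner_consensus_zero_sum[OF w x] inner_consensus_zero_sum[OF w'(1) x]
    by simp
qed

end

end

section \<open>Weighted graph Laplacians\<close>

definition laplacian ::
    "'n set set \<Rightarrow> ('n \<Rightarrow> 'n \<Rightarrow> real) \<Rightarrow> real ^ 'd ^ 'n::finite \<Rightarrow> real ^ 'd ^ 'n" where
  "laplacian E h x = (\<chi> i. \<Sum>j\<in>neighbours E i. h i j *\<^sub>R (x $ i - x $ j))"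

text \<open>
  The discrete Green formula. It exhibits the Laplacian as a symmetric form that only sees
  differences across edges.
\<close>

lemma inner_laplacian:
  fixes x y :: "real ^ 'd ^ 'n::finite"
  assumes sym: "\<And>i j. {i, j} \<in> E \<Longrightarrow> h i j = h j i"
  shows "y \<bullet> laplacian E h x
    = (\<Sum>i\<in>UNIV. \<Sum>j\<in>neighbours E i. h i j * ((y $ i - y $ j) \<bullet> (x $ i - x $ j))) / 2"
proof -
  let ?S = "\<lambda>g. \<Sum>i\<in>UNIV. \<Sum>j\<in>neighbours E i. h i j * g i j"
  have nb: "(\<Sum>j\<in>neighbours E i. G j) = (\<Sum>j\<in>UNIV. if {i, j} \<in> E then G j else 0)"
    for i and G :: "'n \<Rightarrow> real"
    using sum.inter_filter[of UNIV G "\<lambda>j. {i, j} \<in> E"] by (simp add: neighbours_def)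
  have swap: "?S g = ?S (\<lambda>i j. g j i)" for g :: "'n \<Rightarrow> 'n \<Rightarrow> real"
  proof -
    have "?S g = (\<Sum>j\<in>UNIV. \<Sum>i\<in>UNIV. if {i, j} \<in> E then h i j * g i j else 0)"
      unfolding nb by (rule sum.swap)
    also have "\<dots> = ?S (\<lambda>i j. g j i)"
      unfolding nb using sym by (intro sum.cong refl) (auto simp: insert_commute)
    finally show ?thesis .
  qed
  have A: "y \<bullet> laplacian E h x = ?S (\<lambda>i j. y $ i \<bullet> (x $ i - x $ j))"
    by (simp add: inner_blocks laplacian_def inner_sum_right)
  also have "\<dots> = ?S (\<lambda>i j. y $ j \<bullet> (x $ j - x $ i))" by (rule swap)
  finally have B: "y \<bullet> laplacian E h x = ?S (\<lambda>i j. y $ j \<bullet> (x $ j - x $ i))" .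
  have "2 * (y \<bullet> laplacian E h x) = ?S (\<lambda>i j. y $ i \<bullet> (x $ i - x $ j)) + ?S (\<lambda>i j. y $ j \<bullet> (x $ j - x $ i))"
    using A B by simp
  also have "\<dots> = ?S (\<lambda>i j. (y $ i - y $ j) \<bullet> (x $ i - x $ j))"
    unfolding sum.distrib[symmetric] by (intro sum.cong refl) (simp add: algebra_simps)
  finally show ?thesis by simp
qed

lemma laplacian_diff:
  "laplacian E h (x - c *\<^sub>R y) = laplacian E h x - c *\<^sub>R laplacian E h y"
  by (simp add: laplacian_def vec_eq_iff scaleR_sum_right sum_subtractf[symmetric] algebra_simps)

lemma laplacian_zero_sum:
  fixes x :: "real ^ 'd ^ 'n::finite"
  assumes sym: "\<And>i j. {i, j} \<in> E \<Longrightarrow> h i j = h j i"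
  shows "laplacian E h x \<in> zero_sum"
  unfolding zero_sum_eq_orthogonal_comp orthogonal_comp_def orthogonal_def
proof (intro CollectI ballI)
  fix y :: "real ^ 'd ^ 'n" assume "y \<in> consensus"
  then have diff: "y $ i - y $ j = 0" for i j by (simp add: consensus_def)
  have "y \<bullet> laplacian E h x
      = (\<Sum>i\<in>UNIV. \<Sum>j\<in>neighbours E i. h i j * ((y $ i - y $ j) \<bullet> (x $ i - x $ j))) / 2"
    by (rule inner_laplacian) (rule sym)
  then show "y \<bullet> laplacian E h x = 0"
    by (simp only: diff inner_zero_left mult_zero_right sum.neutral_const div_0)
qed

text \<open>
  The weight matrix is the Laplacian on scalar blocks. The diagonal entry survives as is because a
  simple graph has no loops.
\<close>

lemma weight_matrix_mult:
  fixes v :: "real ^ 'n::finite"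
  assumes "simple_graph E"
  shows "(weight_matrix E h *v v) $ i = (\<Sum>j\<in>neighbours E i. h i j * (v $ i - v $ j))"
proof -
  have ii: "{i, i} \<notin> E" using assms by (auto simp: simple_graph_def)
  have nb: "(\<Sum>j\<in>neighbours E i. G j) = (\<Sum>j\<in>UNIV. if {i, j} \<in> E then G j else 0)"
    for G :: "'n \<Rightarrow> real"
    using sum.inter_filter[of UNIV G "\<lambda>j. {i, j} \<in> E"] by (simp add: neighbours_def)
  have "(weight_matrix E h *v v) $ i = (\<Sum>j\<in>UNIV. (if i = j then (\<Sum>s\<in>neighbours E i. h i s) * v $ i else 0)
      + (if {i, j} \<in> E then - (h i j * v $ j) else 0))"
    unfolding matrix_vector_mult_def weight_matrix_def using ii
    by (auto intro!: sum.cong)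
  also have "\<dots> = (\<Sum>s\<in>neighbours E i. h i s) * v $ i + (\<Sum>j\<in>neighbours E i. - (h i j * v $ j))"
    unfolding sum.distrib nb[symmetric] by simp
  also have "\<dots> = (\<Sum>j\<in>neighbours E i. h i j * (v $ i - v $ j))"
    by (simp add: sum_distrib_left sum_distrib_right sum_negf sum_subtractf right_diff_distrib)
  finally show ?thesis .
qed

lemma diag_matrix_mult:
  "diag_matrix a ** diag_matrix b = (diag_matrix (\<lambda>i. a i * b i) :: real ^ 'n ^ 'n::finite)"
proof -
  have "(\<Sum>k\<in>UNIV. (if i = k then a i else 0) * (if k = j then b k else 0))
      = (\<Sum>k\<in>UNIV. if i = k then (if i = j then a i * b i else 0) else 0)" for i j :: 'n
    by (intro sum.cong) auto
  then show ?thesis by (simp add: diag_matrix_def matrix_matrix_mult_def vec_eq_iff)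
qed

lemma matrix_inv_diag_matrix:
  fixes l :: "'n::finite \<Rightarrow> real"
  assumes "\<And>i. l i \<noteq> 0"
  shows "matrix_inv (diag_matrix l) = diag_matrix (\<lambda>i. 1 / l i)"
proof -
  let ?A = "diag_matrix l" and ?B = "diag_matrix (\<lambda>i. 1 / l i)"
  have AB: "?A ** ?B = mat 1" and BA: "?B ** ?A = mat 1"
    using assms by (simp_all add: diag_matrix_mult) (simp_all add: diag_matrix_def mat_def)
  have "matrix_inv ?A ** ?A = mat 1"
    using someI[where P="\<lambda>A'. ?A ** A' = mat 1 \<and> A' ** ?A = mat 1", of ?B] AB BA
    by (simp add: matrix_inv_def)
  then have "matrix_inv ?A ** (?A ** ?B) = ?B" by (simp add: matrix_mul_assoc)
  then show ?thesis by (simp add: AB)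
qed

text \<open>
  The Loewner bound concerns vectors with one scalar per node. It is applied to each coordinate of the
  blocks separately.
\<close>

lemma laplacian_quadratic_le:
  fixes v :: "real ^ 'd ^ 'n::finite"
  assumes "simple_graph E" and \<theta>: "\<And>i. \<theta> i > 0"
    and le: "weight_matrix E h \<preceq> \<delta> *\<^sub>R matrix_inv (diag_matrix (\<lambda>i. 1 / \<theta> i))"
  shows "v \<bullet> laplacian E h v \<le> \<delta> * (\<Sum>i\<in>UNIV. \<theta> i * (norm (v $ i))\<^sup>2)"
proof -
  have inv: "matrix_inv (diag_matrix (\<lambda>i. 1 / \<theta> i)) = diag_matrix \<theta>"
    using \<theta> by (subst matrix_inv_diag_matrix) (auto simp: less_imp_neq[symmetric])
  define u :: "'d \<Rightarrow> real ^ 'n" where "u c = (\<chi> i. v $ i $ c)" for c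
  have diag: "diag_matrix \<theta> *v u c = (\<chi> i. \<theta> i * v $ i $ c)" for c
    by (simp add: u_def diag_matrix_def matrix_vector_mult_def if_distrib if_distribR cong: if_cong)
  have "v \<bullet> laplacian E h v
      = (\<Sum>i\<in>UNIV. \<Sum>c\<in>UNIV. u c $ i * (weight_matrix E h *v u c) $ i)"
    unfolding weight_matrix_mult[OF assms(1)]
    by (simp add: inner_vec_def u_def laplacian_def)
  also have "\<dots> = (\<Sum>c\<in>UNIV. u c \<bullet> (weight_matrix E h *v u c))"
    unfolding inner_vec_def by (subst sum.swap) simp
  also have "\<dots> \<le> (\<Sum>c\<in>UNIV. u c \<bullet> (\<delta> *\<^sub>R (diag_matrix \<theta> *v u c)))"
  proof (rule sum_mono)
    fix c
    have "0 \<le> u c \<bullet> ((\<delta> *\<^sub>R diag_matrix \<theta> - weight_matrix E h) *v u c)"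
      using le unfolding loewner_le_def pos_semidef_def inv by blast
    then show "u c \<bullet> (weight_matrix E h *v u c) \<le> u c \<bullet> (\<delta> *\<^sub>R (diag_matrix \<theta> *v u c))"
      by (simp add: matrix_vector_mult_diff_rdistrib inner_diff_right scaleR_matrix_vector_assoc)
  qed
  also have "\<dots> = \<delta> * (\<Sum>c\<in>UNIV. \<Sum>i\<in>UNIV. \<theta> i * (v $ i $ c)\<^sup>2)"
    unfolding diag by (simp add: inner_vec_def u_def sum_distrib_left power2_eq_square mult_ac)
  also have "\<dots> = \<delta> * (\<Sum>i\<in>UNIV. \<theta> i * (norm (v $ i))\<^sup>2)"
    unfolding power2_norm_eq_inner inner_vec_def
    by (subst sum.swap) (simp add: sum_distrib_left power2_eq_square)
  finally show ?thesis .
qed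

text \<open>
  In matrix terms \<open>H \<preceq> \<delta> \<Lambda>\<inverse>\<close> implies \<open>H \<Lambda> H \<preceq> \<delta> H\<close>. With \<open>u = \<Lambda> H x\<close> it follows from nonnegativity of
  the form of \<open>H\<close> at \<open>x - u / \<delta>\<close>, which replaces the square root of \<open>\<Lambda>\<close> in the usual
  proof.
\<close>

lemma laplacian_norm_le:
  fixes x :: "real ^ 'd ^ 'n::finite"
  assumes "simple_graph E" and \<theta>: "\<And>i. \<theta> i > 0" and \<delta>: "\<delta> > 0"
    and sym: "\<And>i j. {i, j} \<in> E \<Longrightarrow> h i j = h j i"
    and nonneg: "\<And>i j. {i, j} \<in> E \<Longrightarrow> h i j \<ge> 0"
    and le: "weight_matrix E h \<preceq> \<delta> *\<^sub>R matrix_inv (diag_matrix (\<lambda>i. 1 / \<theta> i))"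
  shows "(\<Sum>i\<in>UNIV. (norm (laplacian E h x $ i))\<^sup>2 / \<theta> i) \<le> \<delta> * (x \<bullet> laplacian E h x)"
proof -
  let ?L = "laplacian E h"
  have L: "a \<bullet> ?L b = (\<Sum>i\<in>UNIV. \<Sum>j\<in>neighbours E i. h i j * ((a $ i - a $ j) \<bullet> (b $ i - b $ j))) / 2"
    for a b :: "real ^ 'd ^ 'n"
    by (rule inner_laplacian) (rule sym)
  define u :: "real ^ 'd ^ 'n" where "u = (\<chi> i. ?L x $ i /\<^sub>R \<theta> i)"
  let ?T = "\<Sum>i\<in>UNIV. (norm (?L x $ i))\<^sup>2 / \<theta> i"
  have ux: "u \<bullet> ?L x = ?T"
    unfolding inner_blocks u_def
    by (simp add: power2_norm_eq_inner field_simps)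
  have xu: "x \<bullet> ?L u = ?T"
    unfolding ux[symmetric] L by (simp add: inner_commute)
  have "(\<Sum>i\<in>UNIV. \<theta> i * (norm (u $ i))\<^sup>2) = ?T"
    using \<theta> by (intro sum.cong refl)
      (simp add: u_def power_mult_distrib power2_eq_square less_imp_neq[symmetric] field_simps)
  then have uu: "u \<bullet> ?L u \<le> \<delta> * ?T"
    using laplacian_quadratic_le[OF assms(1) \<theta> le, of u] by simp
  have "0 \<le> (x - (1 / \<delta>) *\<^sub>R u) \<bullet> ?L (x - (1 / \<delta>) *\<^sub>R u)"
    unfolding L using nonneg
    by (auto intro!: sum_nonneg divide_nonneg_pos simp: neighbours_def)
  also have "\<dots> = x \<bullet> ?L x - 2 * ?T / \<delta> + (u \<bullet> ?L u) / \<delta>\<^sup>2"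
  proof -
    have "(x - (1 / \<delta>) *\<^sub>R u) \<bullet> ?L (x - (1 / \<delta>) *\<^sub>R u)
        = x \<bullet> ?L x - (u \<bullet> ?L x) / \<delta> - (x \<bullet> ?L u) / \<delta> + (u \<bullet> ?L u) / \<delta>\<^sup>2"
      by (simp add: laplacian_diff inner_diff_left inner_diff_right diff_divide_distrib
          power2_eq_square)
    then show ?thesis unfolding ux xu by simp
  qed
  also have "\<dots> \<le> x \<bullet> ?L x - 2 * ?T / \<delta> + \<delta> * ?T / \<delta>\<^sup>2"
    using uu \<delta> by (intro add_left_mono divide_right_mono) auto
  also have "\<dots> = x \<bullet> ?L x - ?T / \<delta>" using \<delta> by (simp add: power2_eq_square field_simps)
  finally show ?thesis using \<delta> by (simp add: field_simps)
qed

lemma laplacian_edge_le: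
  fixes x :: "real ^ 'd ^ 'n::finite"
  assumes sym: "\<And>i j. {i, j} \<in> E \<Longrightarrow> h i j = h j i"
    and lo: "\<And>i j. {i, j} \<in> E \<Longrightarrow> lo \<le> h i j" "lo > 0" and uv: "{u, v} \<in> E"
  shows "lo * (norm (x $ u - x $ v))\<^sup>2 \<le> 2 * (x \<bullet> laplacian E h x)"
proof -
  let ?g = "\<lambda>i j. h i j * ((x $ i - x $ j) \<bullet> (x $ i - x $ j))"
  have h: "{i, j} \<in> E \<Longrightarrow> 0 \<le> h i j" for i j using lo(1)[of i j] lo(2) by linarith
  have nn: "0 \<le> ?g i j" if "j \<in> neighbours E i" for i j
    using that h by (auto simp: neighbours_def)
  have "lo * (norm (x $ u - x $ v))\<^sup>2 \<le> ?g u v"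
    using lo(1)[OF uv] by (auto simp: power2_norm_eq_inner intro!: mult_right_mono)
  also have "\<dots> \<le> (\<Sum>j\<in>neighbours E u. ?g u j)"
    using uv nn by (intro member_le_sum) (auto simp: neighbours_def)
  also have "\<dots> \<le> (\<Sum>i\<in>UNIV. \<Sum>j\<in>neighbours E i. ?g i j)"
    by (rule member_le_sum[where f="\<lambda>i. \<Sum>j\<in>neighbours E i. ?g i j"])
      (auto intro!: sum_nonneg nn)
  also have "\<dots> = 2 * (x \<bullet> laplacian E h x)"
    using inner_laplacian[of E h x x, OF sym] by simp
  finally show ?thesis .
qed

section \<open>Convergence of the Fenchel dual gradient method\<close>

locale fenchel_dual_gradient = strongly_convex_family f X \<theta>
  for f :: "'n::finite \<Rightarrow> real ^ 'd \<Rightarrow> real"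
    and X :: "'n \<Rightarrow> (real ^ 'd) set"
    and \<theta> :: "'n \<Rightarrow> real" +
  fixes E :: "nat \<Rightarrow> 'n set set"
    and h :: "nat \<Rightarrow> 'n \<Rightarrow> 'n \<Rightarrow> real"
    and \<alpha> :: "nat \<Rightarrow> real"
    and h_lo \<alpha>_lo \<alpha>_hi \<delta> :: real
    and w x :: "nat \<Rightarrow> real ^ 'd ^ 'n"
  assumes closed_X: "\<And>i. closed (X i)"
    and interior_X: "0 \<in> interior (\<Inter>i. X i)"
    and simple: "\<And>k. simple_graph (E k)"
    and connected: "connected_graph {e. \<exists>\<^sub>\<infinity>k. e \<in> E k}"
    and h_lo_pos: "0 < h_lo"
    and h_sym: "\<And>k i j. {i, j} \<in> E k \<Longrightarrow> h k i j = h k j i"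
    and h_ge: "\<And>k i j. {i, j} \<in> E k \<Longrightarrow> h_lo \<le> h k i j"
    and delta_pos: "0 < \<delta>"
    and weights_le: "\<And>k. weight_matrix (E k) (h k) \<preceq> \<delta> *\<^sub>R matrix_inv (diag_matrix (\<lambda>i. 1 / \<theta> i))"
    and step_lo: "0 < \<alpha>_lo" "\<And>k. \<alpha>_lo \<le> \<alpha> k"
    and step_hi: "\<And>k. \<alpha> k \<le> \<alpha>_hi" "\<alpha>_hi < 2 / \<delta>"
    and iterates: "fenchel_dual_gradient_method f X E h \<alpha> w x"
begin

lemma argmax: "primal_argmax f X (w k) (x k)"
  using iterates by (simp add: fenchel_dual_gradient_method_def primal_argmax_def)

lemma dual_step: "w (Suc k) = w k - \<alpha> k *\<^sub>R laplacian (E k) (h k) (x k)"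
  using iterates by (simp add: fenchel_dual_gradient_method_def laplacian_def vec_eq_iff)

lemma dual_feasible: "w k \<in> zero_sum"
proof (induction k)
  case 0
  show ?case using iterates by (simp add: fenchel_dual_gradient_method_def)
next
  case (Suc k)
  moreover have "laplacian (E k) (h k) (x k) \<in> zero_sum"
    by (rule laplacian_zero_sum) (rule h_sym)
  ultimately show ?case
    by (simp add: dual_step zero_sum_def sum_subtractf flip: scaleR_sum_right)
qed

definition disagreement :: "nat \<Rightarrow> real" where
  "disagreement k = x k \<bullet> laplacian (E k) (h k) (x k)"

lemma laplacian_le_disagreement:
  "(\<Sum>i\<in>UNIV. (norm (laplacian (E k) (h k) (x k) $ i))\<^sup>2 / \<theta> i) \<le> \<delta> * disagreement k"
  unfolding disagreement_def
proof (rule laplacian_norm_le[OF simple theta_pos delta_pos _ _ weights_le])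
  show "h k i j = h k j i" if "{i, j} \<in> E k" for i j using h_sym that .
  show "0 \<le> h k i j" if "{i, j} \<in> E k" for i j using h_ge[OF that] h_lo_pos by simp
qed

lemma disagreement_nonneg: "0 \<le> disagreement k"
proof -
  have "0 \<le> (\<Sum>i\<in>UNIV. (norm (laplacian (E k) (h k) (x k) $ i))\<^sup>2 / \<theta> i)"
    using theta_pos by (intro sum_nonneg divide_nonneg_pos) auto
  also have "\<dots> \<le> \<delta> * disagreement k" by (rule laplacian_le_disagreement)
  finally show ?thesis using delta_pos by (simp add: zero_le_mult_iff)
qed

text \<open>
  In the descent inequality the linear term contributes \<open>- \<alpha> x \<bullet> H x\<close> and the quadratic term at most
  \<open>\<alpha>\<^sup>2 \<delta> / 2\<close> times \<open>x \<bullet> H x\<close>. The upper bound \<open>2 / \<delta>\<close> on the step-sizes is exactly what lets the first win.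
\<close>

lemma dual_decrease:
  "dual_obj f X (w (Suc k)) \<le> dual_obj f X (w k) - \<alpha>_lo * (1 - \<alpha>_hi * \<delta> / 2) * disagreement k"
proof -
  let ?L = "laplacian (E k) (h k) (x k)"
  have "dual_obj f X (w (Suc k)) \<le> dual_obj f X (w k) + (w (Suc k) - w k) \<bullet> x k
      + (\<Sum>i\<in>UNIV. (norm (w (Suc k) $ i - w k $ i))\<^sup>2 / (2 * \<theta> i))"
    by (rule dual_obj_descent[OF argmax])
  also have "(w (Suc k) - w k) \<bullet> x k = - (\<alpha> k * disagreement k)"
    by (simp add: dual_step disagreement_def inner_commute)
  also have "(\<Sum>i\<in>UNIV. (norm (w (Suc k) $ i - w k $ i))\<^sup>2 / (2 * \<theta> i))
      = (\<alpha> k)\<^sup>2 / 2 * (\<Sum>i\<in>UNIV. (norm (?L $ i))\<^sup>2 / \<theta> i)"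
    by (simp add: dual_step sum_distrib_left power_mult_distrib)
  also have "\<dots> \<le> (\<alpha> k)\<^sup>2 / 2 * (\<delta> * disagreement k)"
    by (intro mult_left_mono laplacian_le_disagreement) simp
  finally have "dual_obj f X (w (Suc k))
      \<le> dual_obj f X (w k) - \<alpha> k * (1 - \<alpha> k * \<delta> / 2) * disagreement k"
    by (simp add: power2_eq_square algebra_simps)
  moreover have "\<alpha>_lo * (1 - \<alpha>_hi * \<delta> / 2) \<le> \<alpha> k * (1 - \<alpha> k * \<delta> / 2)"
  proof (rule mult_mono)
    have "\<alpha>_hi * \<delta> \<le> 2" using step_hi(2) delta_pos by (simp add: field_simps)
    then show "0 \<le> 1 - \<alpha>_hi * \<delta> / 2" by simp
    show "1 - \<alpha>_hi * \<delta> / 2 \<le> 1 - \<alpha> k * \<delta> / 2"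
      using step_hi(1)[of k] delta_pos by simp
  qed (use step_lo(1) step_lo(2)[of k] in auto)
  then have "\<alpha>_lo * (1 - \<alpha>_hi * \<delta> / 2) * disagreement k
      \<le> \<alpha> k * (1 - \<alpha> k * \<delta> / 2) * disagreement k"
    by (intro mult_right_mono disagreement_nonneg)
  ultimately show ?thesis by linarith
qed

lemma decrease_factor_pos: "0 < \<alpha>_lo * (1 - \<alpha>_hi * \<delta> / 2)"
proof -
  have "\<alpha>_hi * \<delta> < 2" using step_hi(2) delta_pos by (simp add: field_simps)
  then show ?thesis using step_lo(1) by (intro mult_pos_pos) auto
qed

lemma dual_decseq: "decseq (\<lambda>k. dual_obj f X (w k))"
proof (rule decseq_SucI)
  fix k
  have "0 \<le> \<alpha>_lo * (1 - \<alpha>_hi * \<delta> / 2) * disagreement k"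
    using decrease_factor_pos disagreement_nonneg by simp
  then show "dual_obj f X (w (Suc k)) \<le> dual_obj f X (w k)"
    using dual_decrease[of k] by linarith
qed

lemma dual_convergent: "\<exists>d. (\<lambda>k. dual_obj f X (w k)) \<longlonglongrightarrow> d"
proof -
  have "0 \<in> X i" for i using interior_X interior_subset by blast
  then have "w k \<bullet> 0 - primal_obj f 0 \<le> dual_obj f X (w k)" for k
    by (intro dual_obj_ge[OF argmax]) simp
  then have "\<forall>k. - primal_obj f 0 \<le> dual_obj f X (w k)" by simp
  with decseq_convergent[OF dual_decseq] show ?thesis by meson
qed

lemma disagreement_tendsto: "disagreement \<longlonglongrightarrow> 0"
proof -
  let ?c = "\<alpha>_lo * (1 - \<alpha>_hi * \<delta> / 2)"
  obtain d where d: "(\<lambda>k. dual_obj f X (w k)) \<longlonglongrightarrow> d" using dual_convergent by blast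
  have "(\<lambda>k. (dual_obj f X (w k) - dual_obj f X (w (Suc k))) / ?c) \<longlonglongrightarrow> (d - d) / ?c"
    using decrease_factor_pos by (intro tendsto_intros d LIMSEQ_Suc[OF d]) auto
  then have lim: "(\<lambda>k. (dual_obj f X (w k) - dual_obj f X (w (Suc k))) / ?c) \<longlonglongrightarrow> 0" by simp
  have "disagreement k \<le> (dual_obj f X (w k) - dual_obj f X (w (Suc k))) / ?c" for k
    using dual_decrease[of k] decrease_factor_pos by (simp add: pos_le_divide_eq mult.commute)
  then show ?thesis
    using disagreement_nonneg by (intro tendsto_sandwich[OF _ _ tendsto_const lim]) auto
qed

lemma active_edges_close:
  assumes "\<epsilon> > 0"
  shows "\<forall>\<^sub>F k in sequentially. \<forall>u v. {u, v} \<in> E k \<longrightarrow> norm (x k $ u - x k $ v) < \<epsilon>"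
proof -
  have "0 < h_lo * \<epsilon>\<^sup>2 / 2" using h_lo_pos assms by simp
  from order_tendstoD(2)[OF disagreement_tendsto this] show ?thesis
  proof (eventually_elim, intro allI impI)
    fix k u v
    assume small: "disagreement k < h_lo * \<epsilon>\<^sup>2 / 2" and uv: "{u, v} \<in> E k"
    have "h_lo * (norm (x k $ u - x k $ v))\<^sup>2 \<le> 2 * disagreement k"
      unfolding disagreement_def by (rule laplacian_edge_le[OF h_sym h_ge h_lo_pos uv])
    then have "h_lo * (norm (x k $ u - x k $ v))\<^sup>2 < h_lo * \<epsilon>\<^sup>2" using small by linarith
    then have "(norm (x k $ u - x k $ v))\<^sup>2 < \<epsilon>\<^sup>2" using h_lo_pos by simp
    then show "norm (x k $ u - x k $ v) < \<epsilon>" by (rule power2_less_imp_less) (use assms in simp)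
  qed
qed

lemma bounded_dual: "bounded (range w)"
  by (rule dual_sublevel_bounded[OF interior_X argmax])
    (rule decseqD[OF dual_decseq, of 0], simp)

context
  fixes s :: "nat \<Rightarrow> nat" and w' x' :: "real ^ 'd ^ 'n"
  assumes sub: "strict_mono s"
    and lim_w: "(\<lambda>n. w (s n)) \<longlonglongrightarrow> w'" and lim_x: "(\<lambda>n. x (s n)) \<longlonglongrightarrow> x'"
begin

lemma limit_argmax: "primal_argmax f X w' x'"
  using primal_argmax_limit[OF continuous_f closed_X argmax lim_w lim_x] .

lemma dual_tendsto_limit: "(\<lambda>k. dual_obj f X (w k)) \<longlonglongrightarrow> dual_obj f X w'"
proof -
  obtain d where d: "(\<lambda>k. dual_obj f X (w k)) \<longlonglongrightarrow> d" using dual_convergent by blast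
  have "(\<lambda>n. dual_obj f X (w (s n))) \<longlonglongrightarrow> d"
    using LIMSEQ_subseq_LIMSEQ[OF d sub] by (simp add: o_def)
  moreover have "(\<lambda>n. dual_obj f X (w (s n))) \<longlonglongrightarrow> dual_obj f X w'"
    unfolding dual_obj_eq[OF argmax] dual_obj_eq[OF limit_argmax]
    by (intro tendsto_intros lim_w lim_x tendsto_primal_obj)
  ultimately show ?thesis using d LIMSEQ_unique by blast
qed

text \<open>
  The trapping argument: near a limit point with several values, only edges inside a class of equal
  values can be active, which freezes \<open>x' \<bullet> w\<close> and thereby keeps the iterates near that limit point
  forever.
\<close>

lemma limit_consensus: "x' \<in> consensus"
proof (rule ccontr)
  assume "x' \<notin> consensus"
  then obtain p q where pq: "x' $ p \<noteq> x' $ q" by (auto simp: consensus_def)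
  have "\<exists>u v. {u, v} \<in> {e. \<exists>\<^sub>\<infinity>k. e \<in> E k} \<and> x' $ u \<noteq> x' $ v"
  proof (rule ccontr)
    assume no: "\<not> ?thesis"
    have "(p, q) \<in> {(u, v). {u, v} \<in> {e. \<exists>\<^sub>\<infinity>k. e \<in> E k}}\<^sup>*"
      using connected unfolding connected_graph_def by blast
    then have "x' $ p = x' $ q"
    proof induction
      case (step y z)
      then have "{y, z} \<in> {e. \<exists>\<^sub>\<infinity>k. e \<in> E k}" by blast
      then have "x' $ y = x' $ z" using no by blast
      then show ?case using step by simp
    qed simp
    then show False using pq by simp
  qed
  then obtain u v where uv: "\<exists>\<^sub>\<infinity>k. {u, v} \<in> E k" "x' $ u \<noteq> x' $ v" by blast
  \<comment> \<open>The smallest distance \<open>g\<close> between distinct values of \<open>x'\<close>.\<close>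
  define G where "G = (\<lambda>(i, j). norm (x' $ i - x' $ j)) ` {(i, j). x' $ i \<noteq> x' $ j}"
  have G: "finite G" "G \<noteq> {}" using pq by (auto simp: G_def)
  define g where "g = Min G"
  have "g \<in> G" using G by (simp add: g_def)
  then have g: "g > 0" by (auto simp: G_def)
  have gap: "x' $ i = x' $ j" if "norm (x' $ i - x' $ j) < g" for i j
  proof (rule ccontr)
    assume "x' $ i \<noteq> x' $ j"
    then have "norm (x' $ i - x' $ j) \<in> G" by (auto simp: G_def)
    then show False using Min_le[OF G(1)] that by (fastforce simp: g_def)
  qed
  define m where "m = Min (range \<theta>)"
  have m: "m > 0" "\<And>i. m \<le> \<theta> i" using theta_pos by (simp_all add: m_def)
  \<comment> \<open>With dual value and linear term each within \<open>\<eta>\<close> of their limits, the growth inequality confines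
    all blocks to distance \<open>g / 3\<close> from \<open>x'\<close>. Two such blocks and an active edge shorter than \<open>g / 3\<close>
    then bridge less than \<open>g\<close>.\<close>
  define \<eta> where "\<eta> = m / 4 * (g / 3)\<^sup>2"
  have \<eta>: "\<eta> > 0" using m g by (simp add: \<eta>_def)
  have ev: "\<forall>\<^sub>F k in sequentially. dual_obj f X (w k) < dual_obj f X w' + \<eta> \<and>
      (\<forall>i j. {i, j} \<in> E k \<longrightarrow> norm (x k $ i - x k $ j) < g / 3)"
    using g \<eta> by (intro eventually_conj active_edges_close order_tendstoD(2)[OF dual_tendsto_limit]) auto
  then obtain N where N: "\<And>k. k \<ge> N \<Longrightarrow> dual_obj f X (w k) < dual_obj f X w' + \<eta>"
      "\<And>k i j. k \<ge> N \<Longrightarrow> {i, j} \<in> E k \<Longrightarrow> norm (x k $ i - x k $ j) < g / 3"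
    unfolding eventually_sequentially by blast
  have "(\<lambda>n. x' \<bullet> (w' - w (s n))) \<longlonglongrightarrow> x' \<bullet> (w' - w')"
    by (intro tendsto_intros lim_w)
  then have "\<forall>\<^sub>F n in sequentially. x' \<bullet> (w' - w (s n)) < \<eta>"
    using \<eta> by (intro order_tendstoD(2)) auto
  then obtain n where n: "n \<ge> N" "x' \<bullet> (w' - w (s n)) < \<eta>"
    unfolding eventually_sequentially by (metis nat_le_linear order_refl)
  \<comment> \<open>From this time on the iterates are trapped.\<close>
  define K where "K = s n"
  have K: "K \<ge> N" using n(1) seq_suble[OF sub, of n] by (simp add: K_def)
  have same: "x' $ i = x' $ j" if k: "k \<ge> K" and inv: "x' \<bullet> w k = x' \<bullet> w K" and ij: "{i, j} \<in> E k" for k i j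
  proof -
    have near: "norm (x k $ i - x' $ i) < g / 3" for i
    proof -
      have "m / 2 * (norm (x k $ i - x' $ i))\<^sup>2 \<le> \<theta> i / 2 * (norm (x k $ i - x' $ i))\<^sup>2"
        using m(2)[of i] by (intro mult_right_mono) auto
      also have "\<dots> \<le> (\<Sum>i\<in>UNIV. \<theta> i / 2 * (norm (x k $ i - x' $ i))\<^sup>2)"
        using theta_pos by (intro member_le_sum) (auto simp: less_imp_le)
      also have "\<dots> \<le> dual_obj f X (w k) - dual_obj f X w' + x' \<bullet> (w' - w k)"
        using dual_obj_growth[OF argmax limit_argmax, of k] by (simp add: inner_diff_right)
      also have "\<dots> < \<eta> + \<eta>"
        using N(1)[of k] K k n(2) inv by (simp add: inner_diff_right K_def)
      finally have "m / 2 * (norm (x k $ i - x' $ i))\<^sup>2 < m / 2 * (g / 3)\<^sup>2"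
        by (simp add: \<eta>_def)
      then have "(norm (x k $ i - x' $ i))\<^sup>2 < (g / 3)\<^sup>2" using m(1) by simp
      then show ?thesis by (rule power2_less_imp_less) (use g in simp)
    qed
    let ?a = "x k $ j - x' $ j" and ?b = "x k $ i - x' $ i" and ?c = "x k $ i - x k $ j"
    have "norm (x' $ i - x' $ j) = norm (?a - ?b + ?c)" by simp
    also have "\<dots> \<le> norm ?a + norm ?b + norm ?c"
      using norm_triangle_ineq[of "?a - ?b" ?c] norm_triangle_ineq4[of ?a ?b] by linarith
    also have "\<dots> < g"
      using near[of i] near[of j] N(2)[of k i j] K k ij by linarith
    finally show ?thesis by (rule gap)
  qed
  have inv: "x' \<bullet> w k = x' \<bullet> w K" if "k \<ge> K" for k
    using that
  proof (induction k rule: dec_induct)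
    case (step k)
    have "x' \<bullet> laplacian (E k) (h k) (x k) = (\<Sum>i\<in>UNIV. \<Sum>j\<in>neighbours (E k) i.
        h k i j * ((x' $ i - x' $ j) \<bullet> (x k $ i - x k $ j))) / 2"
      by (rule inner_laplacian) (rule h_sym)
    also have "\<dots> = 0"
    proof -
      have "h k i j * ((x' $ i - x' $ j) \<bullet> (x k $ i - x k $ j)) = 0" if "j \<in> neighbours (E k) i" for i j
        using same[of k i j] step that by (simp add: neighbours_def)
      then have "(\<Sum>j\<in>neighbours (E k) i. h k i j * ((x' $ i - x' $ j) \<bullet> (x k $ i - x k $ j))) = 0" for i
        by (intro sum.neutral) blast
      then show ?thesis by (simp only: sum.neutral_const div_0)
    qed
    finally show ?case using step by (simp add: dual_step inner_diff_right)
  qed simp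
  obtain k where "k \<ge> K" "{u, v} \<in> E k"
    using uv(1) by (auto simp: INFM_nat_le)
  then show False using same[of k u v] inv[of k] uv(2) by blast
qed

end

theorem convergence:
  shows "(\<lambda>k. norm (orth_proj zero_sum (x k))) \<longlonglongrightarrow> 0"
    and "(\<lambda>k. dual_obj f X (w k)) \<longlonglongrightarrow> dual_value f X"
    and "(\<lambda>k. primal_obj f (x k)) \<longlonglongrightarrow> primal_value f X"
    and "x \<longlonglongrightarrow> primal_sol f X"
proof -
  have "bounded (range (\<lambda>k. (w k, x k)))"
    by (rule bounded_subset[OF bounded_Times[OF bounded_dual
            primal_argmax_bounded[OF argmax bounded_dual]]]) auto
  then obtain l s where s: "strict_mono s" "((\<lambda>k. (w k, x k)) \<circ> s) \<longlonglongrightarrow> l"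
    using bounded_imp_convergent_subsequence by blast
  define w' x' where "w' = fst l" and "x' = snd l"
  have lim: "(\<lambda>n. w (s n)) \<longlonglongrightarrow> w'" "(\<lambda>n. x (s n)) \<longlonglongrightarrow> x'"
    using tendsto_fst[OF s(2)] tendsto_snd[OF s(2)] by (simp_all add: w'_def x'_def o_def)
  note argmax' = limit_argmax[OF s(1) lim] and consensus' = limit_consensus[OF s(1) lim]
    and dual' = dual_tendsto_limit[OF s(1) lim]
  have zero': "w' \<in> zero_sum"
  proof -
    have "(\<lambda>n. \<Sum>i\<in>UNIV. w (s n) $ i) \<longlonglongrightarrow> (\<Sum>i\<in>UNIV. w' $ i)"
      by (intro tendsto_intros lim)
    moreover have "(\<Sum>i\<in>UNIV. w (s n) $ i) = 0" for n
      using dual_feasible by (simp add: zero_sum_def)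
    ultimately show ?thesis by (simp add: zero_sum_def LIMSEQ_const_iff)
  qed
  note saddle = argmax' zero' consensus'
  show "(\<lambda>k. dual_obj f X (w k)) \<longlonglongrightarrow> dual_value f X"
    unfolding saddle_dual_value[OF saddle] by (rule dual')
  have xlim: "x \<longlonglongrightarrow> x'"
  proof (rule vec_tendstoI)
    fix i
    have le: "(norm (x k $ i - x' $ i))\<^sup>2 \<le> 2 / \<theta> i * (dual_obj f X (w k) - dual_obj f X w')" for k
    proof -
      have "\<theta> i / 2 * (norm (x k $ i - x' $ i))\<^sup>2 \<le> (\<Sum>i\<in>UNIV. \<theta> i / 2 * (norm (x k $ i - x' $ i))\<^sup>2)"
        using theta_pos by (intro member_le_sum) (auto simp: less_imp_le)
      also have "\<dots> \<le> dual_obj f X (w k) - dual_obj f X w'"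
        using dual_obj_growth[OF argmax argmax', of k]
          inner_consensus_zero_sum[OF dual_feasible consensus', of k]
          inner_consensus_zero_sum[OF zero' consensus']
        by (simp add: inner_diff_right inner_commute)
      finally show ?thesis using theta_pos[of i] by (simp add: field_simps)
    qed
    have "(\<lambda>k. 2 / \<theta> i * (dual_obj f X (w k) - dual_obj f X w'))
        \<longlonglongrightarrow> 2 / \<theta> i * (dual_obj f X w' - dual_obj f X w')"
      by (intro tendsto_intros dual')
    then have lim0: "(\<lambda>k. 2 / \<theta> i * (dual_obj f X (w k) - dual_obj f X w')) \<longlonglongrightarrow> 0" by simp
    have "(\<lambda>k. (norm (x k $ i - x' $ i))\<^sup>2) \<longlonglongrightarrow> 0"
      using le by (intro tendsto_sandwich[OF _ _ tendsto_const lim0]) auto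
    then have "(\<lambda>k. sqrt ((norm (x k $ i - x' $ i))\<^sup>2)) \<longlonglongrightarrow> sqrt 0"
      by (rule tendsto_real_sqrt)
    then have "(\<lambda>k. norm (x k $ i - x' $ i)) \<longlonglongrightarrow> 0" by simp
    then have "(\<lambda>k. x k $ i - x' $ i) \<longlonglongrightarrow> 0" by (rule tendsto_norm_zero_cancel)
    then show "(\<lambda>k. x k $ i) \<longlonglongrightarrow> x' $ i" by (rule LIM_zero_cancel)
  qed
  then show "x \<longlonglongrightarrow> primal_sol f X" unfolding saddle_primal_sol[OF saddle] .
  show "(\<lambda>k. primal_obj f (x k)) \<longlonglongrightarrow> primal_value f X"
    unfolding saddle_primal_value[OF saddle] using tendsto_primal_obj[OF xlim] .
  have "(\<lambda>k. norm (orth_proj zero_sum (x k))) \<longlonglongrightarrow> norm (orth_proj zero_sum x')"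
    unfolding orth_proj_zero_sum
    by (intro tendsto_norm tendsto_diff xlim tendsto_vec_lambda tendsto_scaleR tendsto_const
        tendsto_sum tendsto_vec_nth)
  moreover have "orth_proj zero_sum x' = 0"
  proof -
    have "(\<Sum>j\<in>UNIV. x' $ j) = CARD('n) *\<^sub>R x' $ i" for i
    proof -
      have "(\<Sum>j\<in>UNIV. x' $ j) = (\<Sum>j\<in>(UNIV :: 'n set). x' $ i)"
        using consensus' by (intro sum.cong refl) (simp add: consensus_def)
      then show ?thesis by (simp add: sum_constant_scaleR del: sum_constant)
    qed
    then have "(\<chi> i. (\<Sum>j\<in>UNIV. x' $ j) /\<^sub>R CARD('n)) = (\<chi> i. (CARD('n) *\<^sub>R x' $ i) /\<^sub>R CARD('n))"
      by metis
    also have "\<dots> = x'" by (simp add: vec_eq_iff)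
    finally show ?thesis unfolding orth_proj_zero_sum by simp
  qed
  ultimately show "(\<lambda>k. norm (orth_proj zero_sum (x k))) \<longlonglongrightarrow> 0" by simp
qed

end

theorem theorem1:
  fixes f :: "'n::finite \<Rightarrow> real ^ 'd \<Rightarrow> real"
    and X :: "'n \<Rightarrow> (real ^ 'd) set"
    and \<theta> :: "'n \<Rightarrow> real"
    and E :: "nat \<Rightarrow> 'n set set"
    and h :: "nat \<Rightarrow> 'n \<Rightarrow> 'n \<Rightarrow> real"
    and \<alpha> :: "nat \<Rightarrow> real"
    and h_lo h_hi \<alpha>_lo \<alpha>_hi \<delta> :: real
    and w x :: "nat \<Rightarrow> real ^ 'd ^ 'n"
  assumes "CARD('n) \<ge> 2"
    and "\<And>i. convex_on UNIV (f i)"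
    and "\<And>i. closed (X i)"
    and "\<And>i. convex (X i)"
    and "\<And>i. strongly_convex_over (f i) (X i) (\<theta> i)"
    and "0 \<in> interior (\<Inter>i. X i)"
    and "\<And>k. simple_graph (E k)"
    and "\<And>k. E k \<noteq> {}"
    and "connected_graph {e. \<exists>\<^sub>\<infinity>k. e \<in> E k}"
    and "0 < h_lo"
    and "\<And>k i j. {i, j} \<in> E k \<Longrightarrow> h k i j = h k j i"
    and "\<And>k i j. {i, j} \<in> E k \<Longrightarrow> h k i j \<in> {h_lo..h_hi}"
    and "\<delta> > 0"
    and "\<And>k. weight_matrix (E k) (h k) \<preceq> \<delta> *\<^sub>R matrix_inv (diag_matrix (\<lambda>i. 1 / \<theta> i))"
    and "\<And>k. \<alpha> k \<in> {\<alpha>_lo..\<alpha>_hi}"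
    and "{\<alpha>_lo..\<alpha>_hi} \<subseteq> {0<..<2 / \<delta>}"
    and "fenchel_dual_gradient_method f X E h \<alpha> w x"
  shows "(\<lambda>k. norm (orth_proj zero_sum (x k))) \<longlonglongrightarrow> 0
    \<and> (\<lambda>k. dual_obj f X (w k)) \<longlonglongrightarrow> dual_value f X
    \<and> (\<lambda>k. primal_obj f (x k)) \<longlonglongrightarrow> primal_value f X
    \<and> x \<longlonglongrightarrow> primal_sol f X"
  proof -
  have "\<alpha>_lo \<le> \<alpha>_hi" using \<open>\<And>k. \<alpha> k \<in> {\<alpha>_lo..\<alpha>_hi}\<close>[of 0] by simp
  then have "0 < \<alpha>_lo" "\<alpha>_hi < 2 / \<delta>"
    using \<open>{\<alpha>_lo..\<alpha>_hi} \<subseteq> {0<..<2 / \<delta>}\<close> by auto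
  then interpret fenchel_dual_gradient f X \<theta> E h \<alpha> h_lo \<alpha>_lo \<alpha>_hi \<delta> w x
    using assms by unfold_locales auto
  show ?thesis using convergence by blast
qed

end
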